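(* Let $H=(V,E)$ be a finite hypergraph with $\operatorname{rank}(H)=t\geq 1$, and let $d$ be an integer such that no edge of $H$ intersects more than $d$ other edges of $H$. Then for every integer $v\ge 2$, \[ {\rm VCAN}(H,v)\;\le\;\left\lceil \frac{\ln(d+1)+t\ln v+1}{\ln\frac{v^t}{v^t-1}}\right\rceil\;\le\;\left\lceil v^t\bigl(\ln(d+1)+t\ln v+1\bigr)\right\rceil . \]
   Context: For a hypergraph $H=(V,E)$, $\operatorname{rank}(H)$ is the largest cardinality of an edge of $H$. Let $k=|V|$ and $v\ge 2$. A variable-strength covering array ${\rm VCA}(n;H,v)$ is an $n\times k$ array with entries from $\mathbb{Z}_v$, columns indexed by $V$, such that for every edge $e=\{v_0,\dots,v_{s-1}\}\in E$ the $n\times s$ subarray formed by the columns indexed by $e$ contains every $s$-tuple of $\mathbb{Z}_v^s$ as a row at least once. ${\rm VCAN}(H,v)$ is the smallest $n$ for which a ${\rm VCA}(n;H,v)$ exists. Two edges intersect if they share at least one vertex; $\ln$ is the natural logarithm. *)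

theory Defs
  imports Complex_Main "HOL-Library.FuncSet"
begin

definition finite_hypergraph :: "'a set \<Rightarrow> 'a set set \<Rightarrow> bool" where
  "finite_hypergraph V E \<longleftrightarrow> finite V \<and> E \<subseteq> Pow V"

(* An edgeless hypergraph gets rank 0, so that a rank of at least 1 entails
   the existence of an edge. *)
definition hypergraph_rank :: "'a set set \<Rightarrow> nat" where
  "hypergraph_rank E = (if E = {} then 0 else Max (card ` E))"

(* The entry in row i and column x is A i x; only i < n and x in V matter.
   The ring of integers modulo v is represented by its residues {..<v}, and an
   s-tuple over it, for an edge e with s vertices, by a function from e to {..<v},
   which avoids choosing an enumeration of e. *)
definition VCA :: "nat \<Rightarrow> 'a set \<Rightarrow> 'a set set \<Rightarrow> nat \<Rightarrow> (nat \<Rightarrow> 'a \<Rightarrow> nat) \<Rightarrow> bool" where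
  "VCA n V E v A \<longleftrightarrow>
     (\<forall>i<n. \<forall>x\<in>V. A i x \<in> {..<v}) \<and>
     (\<forall>e\<in>E. \<forall>f \<in> e \<rightarrow>\<^sub>E {..<v}. \<exists>i<n. \<forall>x\<in>e. A i x = f x)"

definition VCAN :: "'a set \<Rightarrow> 'a set set \<Rightarrow> nat \<Rightarrow> nat" where
  "VCAN V E v = (LEAST n. \<exists>A. VCA n V E v A)"

(* The minimum in VCAN is attained: list all rows over V. *)
lemma VCA_exists:
  fixes V :: "'a set" and v :: nat
  assumes "finite_hypergraph V E" and "v \<ge> 2"
  shows "\<exists>n A. VCA n V E v A"
proof -
  have fin: "finite V" and sub: "E \<subseteq> Pow V"
    using assms(1) by (auto simp: finite_hypergraph_def)
  let ?R = "V \<rightarrow>\<^sub>E {..<v}"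
  have fR: "finite ?R" using fin by (simp add: finite_PiE)
  obtain A :: "nat \<Rightarrow> 'a \<Rightarrow> nat" and n where A: "?R = A ` {i. i < n}"
    using finite_imp_nat_seg_image_inj_on[OF fR] by (elim exE conjE) (rule that)
  have "A i x \<in> {..<v}" if "i < n" "x \<in> V" for i x
  proof -
    have "A i \<in> A ` {i. i < n}" using that(1) by (intro imageI CollectI)
    then have "A i \<in> ?R" by (simp only: A)
    then show ?thesis using that(2) by (rule PiE_mem)
  qed
  moreover have "\<exists>i<n. \<forall>x\<in>e. A i x = f x" if e: "e \<in> E" and f: "f \<in> e \<rightarrow>\<^sub>E {..<v}" for e f
  proof -
    let ?g = "\<lambda>x. if x \<in> e then f x else if x \<in> V then 0 else undefined"
    have "?g \<in> ?R" using e f sub assms(2) by (auto simp: PiE_iff extensional_def)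
    then have "?g \<in> A ` {i. i < n}" by (simp only: A)
    then obtain i where i: "i < n" "?g = A i" by (elim imageE CollectE)
    have "A i x = f x" if "x \<in> e" for x
      using fun_cong[OF i(2), of x] that by simp
    then show ?thesis using i(1) by blast
  qed
  ultimately show ?thesis unfolding VCA_def by blast
qed

end

theory Submission
  imports Defs
begin

text \<open>
  Choose the entries of an array with n rows independently and uniformly at random.
  The event that an edge with s vertices misses some tuple has probability at most
  v^s (1 - v^(-s))^n, hence at most v^t (1 - v^(-t))^n, and it is independent of the
  events of all edges disjoint from it.  For n at least the first bound this
  probability is at most 1 / (exp 1 (d + 1)), so the symmetric Lovasz local lemma, stated
  here by counting in a finite sample space, yields an array avoiding all these events.
  The second inequality is ln (q / (q - 1)) \<ge> 1 / q for q = v^t.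
\<close>

section \<open>The Lovasz local lemma\<close>

text \<open>The chain rule for conditional probabilities, in counts: the events of \<open>T\<close>
  are removed one at a time, and each removal keeps at least the fraction \<open>1 - x\<close> of
  what is left. \<open>S\<close> holds the events excluded beforehand, later the non-neighbours of
  an event or the empty set.\<close>

lemma card_avoiding_chain:
  fixes B :: "'e \<Rightarrow> 'w set" and x :: real
  assumes "finite \<Omega>" and "finite T" and "x < 1"
    and step: "\<And>f U. f \<in> T \<Longrightarrow> U \<subseteq> T \<Longrightarrow> f \<notin> U \<Longrightarrow>
      real (card (B f \<inter> (\<Omega> - \<Union>(B ` (S \<union> U))))) \<le> x * real (card (\<Omega> - \<Union>(B ` (S \<union> U))))"
  shows "(1 - x) ^ card T * real (card (\<Omega> - \<Union>(B ` S))) \<le> real (card (\<Omega> - \<Union>(B ` (S \<union> T))))"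
  using assms(2) step
proof (induction T rule: finite_induct)
  case empty
  then show ?case by simp
next
  case (insert f T)
  let ?N = "\<lambda>U. \<Omega> - \<Union>(B ` (S \<union> U))"
  have IH: "(1 - x) ^ card T * real (card (\<Omega> - \<Union>(B ` S))) \<le> real (card (?N T))"
    by (rule insert.IH) (use insert.prems in blast)
  have split: "?N (insert f T) = ?N T - (B f \<inter> ?N T)"
    by auto
  have "card (?N (insert f T)) = card (?N T) - card (B f \<inter> ?N T)"
    unfolding split using assms(1) by (intro card_Diff_subset) auto
  moreover have "card (B f \<inter> ?N T) \<le> card (?N T)"
    using assms(1) by (intro card_mono) auto
  ultimately have "real (card (?N (insert f T))) = real (card (?N T)) - real (card (B f \<inter> ?N T))"
    by simp
  moreover have "real (card (B f \<inter> ?N T)) \<le> x * real (card (?N T))"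
    using insert.hyps by (intro insert.prems) auto
  ultimately have "(1 - x) * real (card (?N T)) \<le> real (card (?N (insert f T)))"
    by (simp add: algebra_simps)
  moreover have "(1 - x) * ((1 - x) ^ card T * real (card (\<Omega> - \<Union>(B ` S)))) \<le> (1 - x) * real (card (?N T))"
    using IH assms(3) by (intro mult_left_mono) auto
  ultimately show ?case
    using insert.hyps by (simp add: mult.assoc)
qed

text \<open>Probabilities are cardinalities and independence is cross-multiplied, so conditioning on
  an empty set causes no division by zero. A single weight \<open>x\<close> serves all
  events.\<close>

locale local_lemma =
  fixes \<Omega> :: "'w set" and E :: "'e set" and B :: "'e \<Rightarrow> 'w set"
    and adj :: "'e \<Rightarrow> 'e \<Rightarrow> bool" and x :: real and d :: nat
  assumes finite_\<Omega>: "finite \<Omega>" and finite_E: "finite E"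
    and x_nonneg: "0 \<le> x" and x_less_1: "x < 1"
    and degree: "\<And>e. e \<in> E \<Longrightarrow> card {f \<in> E. f \<noteq> e \<and> adj f e} \<le> d"
    and independent: "\<And>e T. e \<in> E \<Longrightarrow> T \<subseteq> E \<Longrightarrow> (\<And>f. f \<in> T \<Longrightarrow> \<not> adj f e) \<Longrightarrow>
      card (B e \<inter> (\<Omega> - \<Union>(B ` T))) * card \<Omega> = card (B e) * card (\<Omega> - \<Union>(B ` T))"
    and prob: "\<And>e. e \<in> E \<Longrightarrow> real (card (B e)) \<le> x * (1 - x) ^ d * real (card \<Omega>)"
begin

text \<open>Split \<open>S\<close> into neighbours \<open>S1\<close> and non-neighbours
  \<open>S2\<close> of \<open>e\<close>. Independence handles \<open>S2\<close>; the chain rule with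
  the induction hypothesis shows that excluding \<open>S1\<close> keeps at least the fraction
  \<open>(1 - x) ^ d\<close>, which is the factor provided by \<open>prob\<close>.\<close>

lemma conditional_bound:
  assumes "S \<subseteq> E" and "e \<in> E" and "e \<notin> S"
  shows "real (card (B e \<inter> (\<Omega> - \<Union>(B ` S)))) \<le> x * real (card (\<Omega> - \<Union>(B ` S)))"
  using assms
proof (induction "card S" arbitrary: S e rule: less_induct)
  case less
  let ?N = "\<lambda>S. \<Omega> - \<Union>(B ` S)"
  define S1 where "S1 = {f \<in> S. adj f e}"
  define S2 where "S2 = {f \<in> S. \<not> adj f e}"
  have S: "S2 \<union> S1 = S" and disj: "S1 \<inter> S2 = {}"
    unfolding S1_def S2_def by auto
  have finS: "finite S"
    using less.prems(1) finite_E by (rule finite_subset)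
  have "card S1 \<le> card {f \<in> E. f \<noteq> e \<and> adj f e}"
    unfolding S1_def using less.prems finite_E by (intro card_mono) auto
  also have "\<dots> \<le> d"
    using degree less.prems(2) .
  finally have S1_d: "card S1 \<le> d" .
  have chain: "(1 - x) ^ card S1 * real (card (?N S2)) \<le> real (card (?N (S2 \<union> S1)))"
  proof (rule card_avoiding_chain)
    fix f U assume f: "f \<in> S1" and U: "U \<subseteq> S1" "f \<notin> U"
    have "f \<notin> S2 \<union> U" using f U disj by auto
    moreover have "S2 \<union> U \<subseteq> S" "f \<in> S" using f U S by auto
    ultimately have "S2 \<union> U \<subset> S" by auto
    then have "card (S2 \<union> U) < card S" using finS by (rule psubset_card_mono[rotated])
    then show "real (card (B f \<inter> ?N (S2 \<union> U))) \<le> x * real (card (?N (S2 \<union> U)))"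
      using \<open>f \<notin> S2 \<union> U\<close> \<open>S2 \<union> U \<subseteq> S\<close> \<open>f \<in> S\<close> less.prems(1)
      by (intro less.hyps) auto
  next
    show "finite S1" unfolding S1_def using finS by simp
  qed (simp_all add: finite_\<Omega> x_less_1)
  have N2: "real (card (B e \<inter> ?N S2)) \<le> x * (1 - x) ^ d * real (card (?N S2))"
  proof (cases "card \<Omega> = 0")
    case True
    then have "\<Omega> = {}" using finite_\<Omega> by simp
    then show ?thesis by simp
  next
    case False
    have "card (B e \<inter> ?N S2) * card \<Omega> = card (B e) * card (?N S2)"
      using less.prems by (intro independent) (auto simp: S2_def)
    then have "real (card (B e \<inter> ?N S2)) * real (card \<Omega>) = real (card (B e)) * real (card (?N S2))"
      by (metis of_nat_mult)
    also have "\<dots> \<le> (x * (1 - x) ^ d * real (card \<Omega>)) * real (card (?N S2))"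
      using prob[OF less.prems(2)] by (intro mult_right_mono) auto
    finally have "real (card (B e \<inter> ?N S2)) * real (card \<Omega>)
        \<le> (x * (1 - x) ^ d * real (card (?N S2))) * real (card \<Omega>)"
      by (simp add: mult_ac)
    then show ?thesis using False by simp
  qed
  \<comment> \<open>Forgetting the neighbours only enlarges the set that \<open>B e\<close> is
    intersected with.\<close>
  have "real (card (B e \<inter> ?N S)) \<le> real (card (B e \<inter> ?N S2))"
    using finite_\<Omega> unfolding S2_def by (intro of_nat_mono card_mono) auto
  also have "\<dots> \<le> x * (1 - x) ^ d * real (card (?N S2))"
    by (rule N2)
  also have "\<dots> \<le> x * (1 - x) ^ card S1 * real (card (?N S2))"
    using x_nonneg x_less_1 S1_d
    by (intro mult_right_mono mult_left_mono power_decreasing) auto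
  also have "\<dots> \<le> x * real (card (?N S))"
    using mult_left_mono[OF chain x_nonneg] by (simp add: S mult.assoc)
  finally show ?case .
qed

theorem exists_avoiding:
  assumes "\<Omega> \<noteq> {}"
  shows "\<exists>\<omega>\<in>\<Omega>. \<forall>e\<in>E. \<omega> \<notin> B e"
proof -
  have "0 < (1 - x) ^ card E * real (card \<Omega>)"
    using assms finite_\<Omega> x_less_1 by (simp add: card_gt_0_iff)
  also have "\<dots> \<le> real (card (\<Omega> - \<Union>(B ` E)))"
    using card_avoiding_chain[OF finite_\<Omega> finite_E x_less_1, of B "{}"] conditional_bound
    by (simp add: subset_iff)
  finally have "\<Omega> - \<Union>(B ` E) \<noteq> {}" by (metis card.empty of_nat_0 less_irrefl)
  then show ?thesis by blast
qed

end

text \<open>The weight 1 / (d + 1) would be 1 for d = 0, which the local lemma does not admit.\<close>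

lemma local_lemma_weight:
  fixes d :: nat
  obtains x :: real where "0 \<le> x" "x < 1" "1 / (exp 1 * (real d + 1)) \<le> x * (1 - x) ^ d"
proof (cases "d = 0")
  case True
  \<comment> \<open>For \<open>d = 0\<close> the condition reads 1/e <= \<open>x\<close> < 1, met
    with equality by 1/e.\<close>
  have "1 / exp 1 < (1::real)" by simp
  with True show ?thesis by (intro that[of "1 / exp 1"]) auto
next
  case False
  define x where "x = 1 / (real d + 1)"
  \<comment> \<open>Since \<open>1 - x\<close> is d/(d + 1), its power is the inverse of (1 +
    1/d)^d, which is at most e by 1 + y <= exp y.\<close>
  have "(1 + 1 / real d) ^ d \<le> exp (1 / real d) ^ d"
    by (intro power_mono) auto
  also have "\<dots> = exp 1"
    using False by (simp flip: exp_of_nat_mult)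
  finally have le: "(1 + 1 / real d) ^ d \<le> exp 1" .
  have "1 - x = inverse (1 + 1 / real d)"
    using False unfolding x_def by (simp add: field_simps)
  then have "(1 - x) ^ d = inverse ((1 + 1 / real d) ^ d)"
    by (simp add: power_inverse)
  also have "\<dots> \<ge> inverse (exp 1)"
    using le by (intro le_imp_inverse_le) (auto intro!: zero_less_power add_pos_nonneg)
  finally have "x * inverse (exp 1) \<le> x * (1 - x) ^ d"
    unfolding x_def by (intro mult_left_mono) auto
  then show ?thesis
    using False by (intro that[of x]) (auto simp: x_def field_simps)
qed

section \<open>Random arrays\<close>

text \<open>Extensionality in rows and columns makes the sample space finite, so that the uniform
  distribution is plain counting.\<close>

definition arrays :: "nat \<Rightarrow> 'a set \<Rightarrow> nat \<Rightarrow> (nat \<Rightarrow> 'a \<Rightarrow> nat) set" where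
  "arrays n V v = {..<n} \<rightarrow>\<^sub>E (V \<rightarrow>\<^sub>E {..<v})"

definition uncovered :: "nat \<Rightarrow> 'a set \<Rightarrow> nat \<Rightarrow> 'a set \<Rightarrow> (nat \<Rightarrow> 'a \<Rightarrow> nat) set" where
  "uncovered n V v e =
     {A \<in> arrays n V v. \<exists>f \<in> e \<rightarrow>\<^sub>E {..<v}. \<forall>i<n. \<exists>x\<in>e. A i x \<noteq> f x}"

text \<open>The events that depend only on the columns in \<open>e\<close>. Letting \<open>i\<close>
  range over all naturals is harmless for arrays, which agree on the rows from \<open>n\<close>
  on.\<close>

definition determined_by :: "'a set \<Rightarrow> (nat \<Rightarrow> 'a \<Rightarrow> nat) set \<Rightarrow> (nat \<Rightarrow> 'a \<Rightarrow> nat) set \<Rightarrow> bool" where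
  "determined_by e \<Omega> X \<longleftrightarrow> X \<subseteq> \<Omega> \<and>
     (\<forall>a\<in>X. \<forall>b\<in>\<Omega>. (\<forall>i. \<forall>x\<in>e. a i x = b i x) \<longrightarrow> b \<in> X)"

definition merge_cols :: "'a set \<Rightarrow> (nat \<Rightarrow> 'a \<Rightarrow> nat) \<Rightarrow> (nat \<Rightarrow> 'a \<Rightarrow> nat) \<Rightarrow> nat \<Rightarrow> 'a \<Rightarrow> nat" where
  "merge_cols e a b = (\<lambda>i x. if x \<in> e then a i x else b i x)"

lemma finite_arrays: "finite V \<Longrightarrow> finite (arrays n V v)"
  unfolding arrays_def by (intro finite_PiE) auto

section \<open>Independence of the events of disjoint edges\<close>

lemma merge_cols_arrays:
  assumes "a \<in> arrays n V v" and "b \<in> arrays n V v"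
  shows "merge_cols e a b \<in> arrays n V v"
  using assms unfolding arrays_def merge_cols_def
  by (auto simp: PiE_iff extensional_def fun_eq_iff)

lemma determined_byD:
  assumes "determined_by e \<Omega> X" and "a \<in> X" and "b \<in> \<Omega>" and "\<And>i x. x \<in> e \<Longrightarrow> a i x = b i x"
  shows "b \<in> X"
  using assms unfolding determined_by_def by blast

text \<open>Exchanging the columns outside e between two arrays is an involution on pairs of
  arrays, and it carries (X \<inter> Y) \<times> \<Omega> onto X \<times> Y.\<close>

lemma card_Int_determined_by:
  fixes V :: "'a set" and n v :: nat
  defines "\<Omega> \<equiv> arrays n V v"
  assumes X: "determined_by e \<Omega> X" and Y: "determined_by (- e) \<Omega> Y"
  shows "card (X \<inter> Y) * card \<Omega> = card X * card Y"
proof -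
  let ?h = "\<lambda>(a, b). (merge_cols e a b, merge_cols e b a)"
  have sub: "X \<subseteq> \<Omega>" "Y \<subseteq> \<Omega>"
    using X Y by (auto simp: determined_by_def)
  have m: "merge_cols e a b \<in> \<Omega>" if "a \<in> \<Omega>" "b \<in> \<Omega>" for a b
    using that unfolding \<Omega>_def by (rule merge_cols_arrays)
  \<comment> \<open>Each merged array agrees with \<open>a\<close> on exactly the columns that
    decide the event: those in \<open>e\<close> for \<open>X\<close>, those outside \<open>e\<close>
    for \<open>Y\<close>.\<close>
  have mX: "merge_cols e a b \<in> X" if "a \<in> X" "b \<in> \<Omega>" for a b
    by (rule determined_byD[OF X that(1)]) (use that sub m in \<open>auto simp: merge_cols_def\<close>)
  have mY: "merge_cols e b a \<in> Y" if "a \<in> Y" "b \<in> \<Omega>" for a b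
    by (rule determined_byD[OF Y that(1)]) (use that sub m in \<open>auto simp: merge_cols_def\<close>)
  have inv: "?h (?h p) = p" for p
    by (cases p) (auto simp: merge_cols_def fun_eq_iff)
  have "bij_betw ?h ((X \<inter> Y) \<times> \<Omega>) (X \<times> Y)"
  proof (rule bij_betw_byWitness[where f' = ?h])
    show "?h ` ((X \<inter> Y) \<times> \<Omega>) \<subseteq> X \<times> Y"
      using mX mY by auto
    show "?h ` (X \<times> Y) \<subseteq> (X \<inter> Y) \<times> \<Omega>"
      using mX mY m sub by (auto simp: subset_iff)
  qed (use inv in auto)
  then show ?thesis
    by (simp add: bij_betw_same_card flip: card_cartesian_product)
qed

lemma uncovered_determined_by: "determined_by e (arrays n V v) (uncovered n V v e)"
  unfolding determined_by_def
proof (intro conjI ballI impI)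
  show "uncovered n V v e \<subseteq> arrays n V v" by (auto simp: uncovered_def)
  fix a b
  assume a: "a \<in> uncovered n V v e" and b: "b \<in> arrays n V v"
    and eq: "\<forall>i. \<forall>x\<in>e. a i x = b i x"
  from a obtain f where f: "f \<in> e \<rightarrow>\<^sub>E {..<v}" "\<forall>i<n. \<exists>x\<in>e. a i x \<noteq> f x"
    by (auto simp: uncovered_def)
  from f(2) eq have "\<forall>i<n. \<exists>x\<in>e. b i x \<noteq> f x" by metis
  with b f(1) show "b \<in> uncovered n V v e" unfolding uncovered_def by blast
qed

text \<open>Each edge in \<open>T\<close> lies in the complement of \<open>e\<close>, so the columns
  there decide its event, and hence also whether all these events are avoided.\<close>

lemma avoiding_determined_by:
  assumes "\<And>f. f \<in> T \<Longrightarrow> f \<inter> e = {}"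
  shows "determined_by (- e) (arrays n V v) (arrays n V v - \<Union>(uncovered n V v ` T))"
  unfolding determined_by_def
proof (intro conjI ballI impI)
  fix a b
  assume a: "a \<in> arrays n V v - \<Union>(uncovered n V v ` T)" and b: "b \<in> arrays n V v"
    and eq: "\<forall>i. \<forall>x\<in>- e. a i x = b i x"
  have "b \<notin> uncovered n V v f" if f: "f \<in> T" for f
  proof
    assume "b \<in> uncovered n V v f"
    then have "a \<in> uncovered n V v f"
      by (rule determined_byD[OF uncovered_determined_by]) (use a eq assms[OF f] in \<open>auto simp: disjoint_iff\<close>)
    with a f show False by blast
  qed
  with b show "b \<in> arrays n V v - \<Union>(uncovered n V v ` T)" by blast
qed auto

section \<open>Probability that an edge is left uncovered\<close>

lemma card_rows_extending:
  assumes "finite V" and "e \<subseteq> V" and "f \<in> e \<rightarrow>\<^sub>E {..<v}"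
  shows "card {r \<in> V \<rightarrow>\<^sub>E {..<v}. \<forall>x\<in>e. r x = f x} * v ^ card e = v ^ card V"
proof -
  \<comment> \<open>Prescribing values on \<open>e\<close> turns the factors at \<open>e\<close>
    into singletons, which makes the set a dependent product of known cardinality.\<close>
  have "{r \<in> V \<rightarrow>\<^sub>E {..<v}. \<forall>x\<in>e. r x = f x} = PiE V (\<lambda>x. if x \<in> e then {f x} else {..<v})"
    (is "?L = ?R")
  proof
    show "?L \<subseteq> ?R" by (auto simp: PiE_iff extensional_def)
    show "?R \<subseteq> ?L"
    proof
      fix r assume r: "r \<in> ?R"
      have *: "r x \<in> (if x \<in> e then {f x} else {..<v})" if "x \<in> V" for x
        using r that by (rule PiE_mem)
      have "r x = f x" if "x \<in> e" for x
        using *[of x] that assms(2) by auto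
      moreover have "r x < v" if "x \<in> V" for x
        using *[of x] that assms(3) by (auto simp: PiE_iff split: if_splits)
      ultimately show "r \<in> ?L"
        using r by (auto simp: PiE_iff extensional_def)
    qed
  qed
  then have "card ?L = (\<Prod>x\<in>V. if x \<in> e then 1 else v)"
    using assms(1) by (simp add: card_PiE if_distrib cong: if_cong)
  also have "\<dots> = v ^ card (V - e)"
    using assms(1) by (simp add: prod.If_cases Diff_eq)
  finally show ?thesis
    using assms(1,2) by (simp add: card_Diff_subset finite_subset card_mono flip: power_add)
qed

lemma card_arrays_missing:
  assumes "finite V" and "e \<subseteq> V" and "f \<in> e \<rightarrow>\<^sub>E {..<v}" and "v \<ge> 1"
  shows "real (card {A \<in> arrays n V v. \<forall>i<n. \<exists>x\<in>e. A i x \<noteq> f x})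
    = (1 - 1 / real v ^ card e) ^ n * real (card (arrays n V v))"
proof -
  let ?R = "V \<rightarrow>\<^sub>E {..<v}" and ?G = "{r \<in> V \<rightarrow>\<^sub>E {..<v}. \<forall>x\<in>e. r x = f x}"
  \<comment> \<open>Missing \<open>f\<close> is a condition on each row separately, so the count is
    an \<open>n\<close>-th power.\<close>
  have "{A \<in> arrays n V v. \<forall>i<n. \<exists>x\<in>e. A i x \<noteq> f x} = {..<n} \<rightarrow>\<^sub>E (?R - ?G)"
    unfolding arrays_def by (auto simp: PiE_iff extensional_def)
  then have "card {A \<in> arrays n V v. \<forall>i<n. \<exists>x\<in>e. A i x \<noteq> f x} = card (?R - ?G) ^ n"
    by (simp add: card_PiE)
  moreover have "real (card (?R - ?G)) = (1 - 1 / real v ^ card e) * real (card ?R)"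
  proof -
    have fin: "finite ?R" using assms(1) by (simp add: finite_PiE)
    have R: "card ?R = v ^ card V" using assms(1) by (simp add: card_PiE)
    have "card (?R - ?G) = card ?R - card ?G"
      using fin by (intro card_Diff_subset) (auto intro: finite_subset)
    moreover have "card ?G \<le> card ?R" using fin by (intro card_mono) auto
    ultimately have "real (card (?R - ?G)) = real (card ?R) - real (card ?G)" by simp
    moreover have "real (card ?G) = real (card ?R) / real v ^ card e"
      using arg_cong[OF card_rows_extending[OF assms(1-3)], of real] R assms(4)
      by (simp add: eq_divide_eq)
    ultimately show ?thesis by (simp add: left_diff_distrib)
  qed
  moreover have "card (arrays n V v) = card ?R ^ n"
    unfolding arrays_def by (simp add: card_PiE)
  ultimately show ?thesis by (simp add: power_mult_distrib)
qed

text \<open>A union bound over the tuples on \<open>e\<close>. With s = \<open>card e\<close>, both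
  v^s and (1 - v^(-s))^n grow with s, so s may be replaced by \<open>t\<close>.\<close>

lemma card_uncovered:
  assumes "finite V" and "e \<subseteq> V" and "v \<ge> 1" and "card e \<le> t"
  shows "real (card (uncovered n V v e))
    \<le> real v ^ t * (1 - 1 / real v ^ t) ^ n * real (card (arrays n V v))"
proof -
  let ?F = "e \<rightarrow>\<^sub>E {..<v}" and ?M = "\<lambda>f. {A \<in> arrays n V v. \<forall>i<n. \<exists>x\<in>e. A i x \<noteq> f x}"
  have fe: "finite e" using assms(1,2) by (rule finite_subset[rotated])
  have finF: "finite ?F" using fe by (simp add: finite_PiE)
  have le: "(1 - 1 / real v ^ card e) ^ n \<le> (1 - 1 / real v ^ t) ^ n"
    using assms(3,4) by (intro power_mono diff_left_mono divide_left_mono power_increasing) auto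
  have "uncovered n V v e = (\<Union>f\<in>?F. ?M f)"
    unfolding uncovered_def by auto
  then have "real (card (uncovered n V v e)) \<le> (\<Sum>f\<in>?F. real (card (?M f)))"
    using card_UN_le[OF finF, of ?M] by (simp flip: of_nat_sum)
  also have "\<dots> = real v ^ card e * (1 - 1 / real v ^ card e) ^ n * real (card (arrays n V v))"
    using card_arrays_missing[OF assms(1,2) _ assms(3)] fe by (simp add: card_PiE)
  also have "\<dots> \<le> real v ^ t * (1 - 1 / real v ^ t) ^ n * real (card (arrays n V v))"
    using le assms(3,4) by (intro mult_right_mono mult_mono power_increasing) auto
  finally show ?thesis .
qed

section \<open>The local lemma applied to random arrays\<close>

lemma VCA_existence:
  fixes d :: nat
  assumes H: "finite_hypergraph V E"
    and rank: "\<And>e. e \<in> E \<Longrightarrow> card e \<le> t"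
    and deg: "\<And>e. e \<in> E \<Longrightarrow> card {f \<in> E. f \<noteq> e \<and> f \<inter> e \<noteq> {}} \<le> d"
    and v: "v \<ge> 1"
    and p: "real v ^ t * (1 - 1 / real v ^ t) ^ n \<le> 1 / (exp 1 * (real d + 1))"
  shows "\<exists>A. VCA n V E v A"
proof -
  have finV: "finite V" and sub: "\<And>e. e \<in> E \<Longrightarrow> e \<subseteq> V"
    using H by (auto simp: finite_hypergraph_def)
  have finE: "finite E"
    using H by (auto simp: finite_hypergraph_def intro: finite_subset)
  obtain x :: real where x: "0 \<le> x" "x < 1" "1 / (exp 1 * (real d + 1)) \<le> x * (1 - x) ^ d"
    by (rule local_lemma_weight)
  \<comment> \<open>Adjacent means sharing a vertex. The event of \<open>e\<close> is decided by the
    columns in \<open>e\<close>, and avoidance for edges disjoint from \<open>e\<close> by the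
    remaining columns, which gives independence.\<close>
  interpret local_lemma "arrays n V v" E "uncovered n V v" "\<lambda>f e. f \<inter> e \<noteq> {}" x d
  proof
    fix e T assume "e \<in> E" "T \<subseteq> E" and T: "\<And>f. f \<in> T \<Longrightarrow> \<not> f \<inter> e \<noteq> {}"
    show "card (uncovered n V v e \<inter> (arrays n V v - \<Union>(uncovered n V v ` T))) * card (arrays n V v)
      = card (uncovered n V v e) * card (arrays n V v - \<Union>(uncovered n V v ` T))"
      by (rule card_Int_determined_by[OF uncovered_determined_by avoiding_determined_by]) (use T in auto)
  next
    fix e assume e: "e \<in> E"
    have "real (card (uncovered n V v e))
        \<le> real v ^ t * (1 - 1 / real v ^ t) ^ n * real (card (arrays n V v))"
      using finV sub[OF e] v rank[OF e] by (rule card_uncovered)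
    also have "\<dots> \<le> x * (1 - x) ^ d * real (card (arrays n V v))"
      using p x(3) by (intro mult_right_mono) auto
    finally show "real (card (uncovered n V v e)) \<le> x * (1 - x) ^ d * real (card (arrays n V v))" .
  qed (use finV finE x deg in \<open>simp_all add: finite_arrays\<close>)
  have "arrays n V v \<noteq> {}"
    using v unfolding arrays_def by (auto simp: PiE_eq_empty_iff lessThan_empty_iff)
  then obtain A where A: "A \<in> arrays n V v" "\<And>e. e \<in> E \<Longrightarrow> A \<notin> uncovered n V v e"
    using exists_avoiding by blast
  have "VCA n V E v A"
    unfolding VCA_def
  proof (intro conjI allI impI ballI)
    fix i x assume "i < n" "x \<in> V"
    then show "A i x \<in> {..<v}" using A(1) by (auto simp: arrays_def PiE_iff)
  next
    fix e f assume "e \<in> E" "f \<in> e \<rightarrow>\<^sub>E {..<v}"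
    then show "\<exists>i<n. \<forall>x\<in>e. A i x = f x"
      using A unfolding uncovered_def by blast
  qed
  then show ?thesis by blast
qed

section \<open>The bounds\<close>

text \<open>This is ln y <= y - 1 at y = (q - 1)/q, with both sides negated.\<close>

lemma inverse_le_ln_ratio:
  fixes q :: real
  assumes "q > 1"
  shows "1 / q \<le> ln (q / (q - 1))"
proof -
  have "ln ((q - 1) / q) \<le> (q - 1) / q - 1"
    using assms by (intro ln_le_minus_one) simp
  moreover have "ln (q / (q - 1)) = - ln ((q - 1) / q)"
    using assms by (simp add: ln_div)
  moreover have "(q - 1) / q - 1 = - (1 / q)"
    using assms by (simp add: field_simps)
  ultimately show ?thesis by linarith
qed

text \<open>Taking logarithms turns the conclusion into ln q - n ln(q/(q - 1)) <= -(1 + ln D), which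
  is the hypothesis on \<open>n\<close> solved for \<open>n\<close>. It is applied with q = v^t and
  D = d + 1.\<close>

lemma failure_probability_bound:
  fixes q D :: real
  assumes "q > 1" and "D > 0" and n: "(ln D + ln q + 1) / ln (q / (q - 1)) \<le> real n"
  shows "q * (1 - 1 / q) ^ n \<le> 1 / (exp 1 * D)"
proof -
  have L: "ln (q / (q - 1)) > 0"
    using assms(1) by simp
  have "ln D + ln q + 1 \<le> real n * ln (q / (q - 1))"
    using n L by (simp add: pos_divide_le_eq)
  moreover have "ln (1 - 1 / q) = - ln (q / (q - 1))"
    using assms(1) by (simp add: ln_div diff_divide_distrib[symmetric] field_simps flip: ln_inverse)
  moreover have "1 - 1 / q > 0" using assms(1) by simp
  ultimately have "ln (q * (1 - 1 / q) ^ n) \<le> - (1 + ln D)"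
    using assms(1) by (simp add: ln_mult ln_realpow)
  also have "\<dots> = ln (1 / (exp 1 * D))"
    using assms(2) by (simp add: ln_div ln_mult)
  finally show ?thesis
    using assms(1,2) \<open>1 - 1 / q > 0\<close> by (subst (asm) ln_le_cancel_iff) auto
qed

theorem theorem2:
  fixes V :: "'a set" and E :: "'a set set" and t v :: nat and d :: int
  assumes "finite_hypergraph V E"
    and "hypergraph_rank E = t" and "t \<ge> 1"
    and "\<forall>e\<in>E. int (card {f\<in>E. f \<noteq> e \<and> f \<inter> e \<noteq> {}}) \<le> d"
    and "v \<ge> 2"
  shows "int (VCAN V E v)
           \<le> \<lceil>(ln (real_of_int d + 1) + real t * ln (real v) + 1)
                / ln (real v ^ t / (real v ^ t - 1))\<rceil>
       \<and> \<lceil>(ln (real_of_int d + 1) + real t * ln (real v) + 1)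
                / ln (real v ^ t / (real v ^ t - 1))\<rceil>
           \<le> \<lceil>real v ^ t * (ln (real_of_int d + 1) + real t * ln (real v) + 1)\<rceil>"
proof -
  \<comment> \<open>A positive rank forces an edge, and the degree bound at that edge forces
    \<open>d\<close> to be nonnegative, so that \<open>nat d\<close> loses nothing.\<close>
  have "E \<noteq> {}"
    using assms(2,3) by (auto simp: hypergraph_rank_def)
  then have d: "d \<ge> 0"
    using assms(4) by (meson all_not_in_conv of_nat_0_le_iff order_trans)
  have finE: "finite E"
    using assms(1) by (auto simp: finite_hypergraph_def intro: finite_subset)
  have rank: "card e \<le> t" if "e \<in> E" for e
    using that assms(2) finE by (auto simp: hypergraph_rank_def split: if_splits)
  define q where "q = real v ^ t"
  define D where "D = real_of_int d + 1"
  define m where "m = ln D + ln q + 1"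
  have q: "q > 1"
    unfolding q_def using assms(3,5) by (intro one_less_power) auto
  have D: "D \<ge> 1" unfolding D_def using d by simp
  have m: "m \<ge> 0" unfolding m_def using q D by simp
  have lnq: "real t * ln (real v) = ln q"
    unfolding q_def using assms(5) by (simp add: ln_realpow)
  define n where "n = nat \<lceil>m / ln (q / (q - 1))\<rceil>"
  have L: "ln (q / (q - 1)) > 0" using q by simp
  have "m / ln (q / (q - 1)) \<le> real n"
    unfolding n_def by (rule real_nat_ceiling_ge)
  then have "q * (1 - 1 / q) ^ n \<le> 1 / (exp 1 * D)"
    using q D unfolding m_def by (intro failure_probability_bound) auto
  then have "\<exists>A. VCA n V E v A"
    using assms(1,4,5) rank d
    by (intro VCA_existence[where t = t and d = "nat d"]) (auto simp: q_def D_def)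
  then have "VCAN V E v \<le> n"
    unfolding VCAN_def by (rule Least_le)
  \<comment> \<open>Nonnegativity of \<open>m\<close> ensures that \<open>nat\<close> does not
    truncate the ceiling.\<close>
  moreover have "int n = \<lceil>m / ln (q / (q - 1))\<rceil>"
  proof -
    have "0 \<le> m / ln (q / (q - 1))" using m L by (intro divide_nonneg_pos)
    then show ?thesis unfolding n_def by simp
  qed
  moreover have "m / ln (q / (q - 1)) \<le> q * m"
  proof -
    \<comment> \<open>Shrinking the positive denominator to 1/q can only increase the quotient,
      because \<open>m\<close> is nonnegative.\<close>
    have "m / ln (q / (q - 1)) \<le> m / (1 / q)"
      using m q L inverse_le_ln_ratio[OF q] by (intro divide_left_mono) auto
    then show ?thesis by (simp add: mult.commute)
  qed
  then have "\<lceil>m / ln (q / (q - 1))\<rceil> \<le> \<lceil>q * m\<rceil>"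
    by (rule ceiling_mono)
  ultimately show ?thesis
    unfolding lnq q_def[symmetric] D_def[symmetric] m_def[symmetric] by linarith
qed

end
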